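(* Let $\alpha>1$ and $p\in[0,1]$. The function $$u_{2\alpha,p}(x,t)=\frac{1}{(\alpha t)^{1/\alpha}}\left[p\,\mathrm{Ai}_{\alpha}\left(-\frac{x}{(\alpha t)^{1/\alpha}}\right)+(1-p)\,\mathrm{Ai}_{\alpha}\left(\frac{x}{(\alpha t)^{1/\alpha}}\right)\right],\qquad x\in\mathbb{R},\ t>0,$$ is a solution to the space-fractional partial differential equation $$\frac{\partial^2 u}{\partial t^2}=\frac{\partial^{2\alpha}u}{\partial|x|^{2\alpha}},\qquad x\in\mathbb{R},\ t>0,$$ in the sense that its Fourier transform in $x$ satisfies $\frac{\partial^2\widehat u_{2\alpha,p}}{\partial t^2}(\gamma,t)=-|\gamma|^{2\alpha}\,\widehat u_{2\alpha,p}(\gamma,t)$ for all $\gamma\in\mathbb{R}$, $t>0$.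
   Context: For real $\alpha>1$ the generalized Airy function is $\mathrm{Ai}_{\alpha}(x)=\frac{1}{\pi}\int_0^{+\infty}\cos\left(sx+\frac{s^{\alpha}}{\alpha}\right)ds$, $x\in\mathbb{R}$ (convergent improper Riemann integral). The Fourier transform is $\widehat u(\gamma,t)=\int_{-\infty}^{+\infty}e^{i\gamma x}u(x,t)\,dx$, in the sense of tempered distributions in $x$ (here it is represented by a function of $\gamma$, taken in its continuous-in-$\gamma$ representative). The Riesz fractional derivative of order $\beta>0$ is defined by $\mathcal{F}\left\{\frac{\partial^{\beta}f}{\partial|x|^{\beta}}\right\}(\gamma)=-|\gamma|^{\beta}\mathcal{F}\{f\}(\gamma)$. *)

theory Defs
  imports "HOL-Analysis.Analysis"
begin

definition Airy_gen :: "real \<Rightarrow> real \<Rightarrow> real" where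
  "Airy_gen \<alpha> x =
     (1 / pi) * Lim at_top (\<lambda>R. integral {0..R} (\<lambda>s. cos (s * x + s powr \<alpha> / \<alpha>)))"

definition airy_sol :: "real \<Rightarrow> real \<Rightarrow> real \<Rightarrow> real \<Rightarrow> real" where
  "airy_sol \<alpha> p x t =
     1 / (\<alpha> * t) powr (1 / \<alpha>) *
       (p * Airy_gen \<alpha> (- (x / (\<alpha> * t) powr (1 / \<alpha>)))
        + (1 - p) * Airy_gen \<alpha> (x / (\<alpha> * t) powr (1 / \<alpha>)))"

definition iter_deriv :: "nat \<Rightarrow> (real \<Rightarrow> complex) \<Rightarrow> real \<Rightarrow> complex" where
  "iter_deriv n f = ((\<lambda>g x. vector_derivative g (at x)) ^^ n) f"

definition schwartz_space :: "(real \<Rightarrow> complex) set" where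
  "schwartz_space =
     {\<phi>. \<forall>n. (\<forall>x. iter_deriv n \<phi> differentiable (at x)) \<and>
              (\<forall>m. bounded (range (\<lambda>x. x ^ m *\<^sub>R iter_deriv n \<phi> x)))}"

definition schwartz_seminorm :: "nat \<Rightarrow> nat \<Rightarrow> (real \<Rightarrow> complex) \<Rightarrow> real" where
  "schwartz_seminorm m n \<phi> = (SUP x. norm (x ^ m *\<^sub>R iter_deriv n \<phi> x))"

text \<open>Tempered distributions are total functions on \<^typ>\<open>real \<Rightarrow> complex\<close> of which only the
  values on Schwartz functions matter. The bound expresses continuity in the Schwartz topology.\<close>

definition tempered_distribution :: "((real \<Rightarrow> complex) \<Rightarrow> complex) \<Rightarrow> bool" where
  "tempered_distribution T \<longleftrightarrow>
     (\<forall>\<phi>\<in>schwartz_space. \<forall>\<psi>\<in>schwartz_space. T (\<lambda>x. \<phi> x + \<psi> x) = T \<phi> + T \<psi>) \<and>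
     (\<forall>c. \<forall>\<phi>\<in>schwartz_space. T (\<lambda>x. c * \<phi> x) = c * T \<phi>) \<and>
     (\<exists>C N. \<forall>\<phi>\<in>schwartz_space.
        norm (T \<phi>) \<le> C * (\<Sum>m\<le>N. \<Sum>n\<le>N. schwartz_seminorm m n \<phi>))"

definition distribution_of :: "(real \<Rightarrow> complex) \<Rightarrow> (real \<Rightarrow> complex) \<Rightarrow> complex" where
  "distribution_of f \<phi> = (LINT x|lborel. f x * \<phi> x)"

text \<open>The integrability clause excludes the junk value \<open>0\<close> of the Bochner integral.\<close>

definition tempered_function :: "(real \<Rightarrow> complex) \<Rightarrow> bool" where
  "tempered_function f \<longleftrightarrow>
     f \<in> borel_measurable lborel \<and>
     (\<forall>\<phi>\<in>schwartz_space. integrable lborel (\<lambda>x. f x * \<phi> x)) \<and>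
     tempered_distribution (distribution_of f)"

definition fourier_test :: "(real \<Rightarrow> complex) \<Rightarrow> real \<Rightarrow> complex" where
  "fourier_test \<phi> \<gamma> = (LINT x|lborel. exp (\<i> * of_real (\<gamma> * x)) * \<phi> x)"

definition fourier_distribution ::
    "((real \<Rightarrow> complex) \<Rightarrow> complex) \<Rightarrow> (real \<Rightarrow> complex) \<Rightarrow> complex" where
  "fourier_distribution T \<phi> = T (fourier_test \<phi>)"

text \<open>\<open>g\<close> represents the distributional Fourier transform of \<open>f\<close>. It is determined up to null
  sets, hence uniquely if required to be continuous.\<close>

definition has_fourier_transform :: "(real \<Rightarrow> complex) \<Rightarrow> (real \<Rightarrow> complex) \<Rightarrow> bool" where
  "has_fourier_transform f g \<longleftrightarrow>
     tempered_function f \<and> tempered_function g \<and>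
     (\<forall>\<phi>\<in>schwartz_space.
        fourier_distribution (distribution_of f) \<phi> = distribution_of g \<phi>)"

end

theory Submission
  imports Defs "HOL-Probability.Probability" "HOL-Real_Asymp.Real_Asymp"
begin

text \<open>Rescaling the Airy integral exhibits \<open>u(\<cdot>,t)\<close> as the pointwise limit of the truncated inverse
  Fourier integrals of \<open>U(\<gamma>,t) = p exp(i\<sigma>t) + (1 - p) exp(-i\<sigma>t)\<close> with \<open>\<sigma> = sgn(\<gamma>)|\<gamma>|\<^sup>\<alpha>\<close>, and
  \<open>\<sigma>\<^sup>2 = |\<gamma>|\<^sup>2\<^sup>\<alpha>\<close> gives the differential equation. The van der Corput estimate shows that
  the truncated integrals converge and grow at most polynomially in \<open>x\<close>, uniformly in the cutoff, so
  the limit may be taken under the pairing with the rapidly decreasing Fourier transform of a test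
  function; the truncated pairings are evaluated by Fubini and Fourier inversion.\<close>

section \<open>Fourier transforms of Schwartz functions\<close>

text \<open>The decay half of the Schwartz condition, isolated so that it also applies to Fourier
  transforms of test functions, for which decay alone is proved.\<close>

definition rapidly_decreasing :: "(real \<Rightarrow> complex) \<Rightarrow> bool" where
  "rapidly_decreasing h \<longleftrightarrow> (\<forall>m. bounded (range (\<lambda>x. x ^ m *\<^sub>R h x)))"

lemma rapidly_decreasing_le_seminorm:
  assumes "rapidly_decreasing h"
  shows "\<bar>x\<bar> ^ m * norm (h x) \<le> schwartz_seminorm m 0 h"
proof -
  have "bdd_above (range (\<lambda>x. norm (x ^ m *\<^sub>R h x)))"
    using assms unfolding rapidly_decreasing_def bounded_iff bdd_above_def by fastforce
  then have "norm (x ^ m *\<^sub>R h x) \<le> (SUP x. norm (x ^ m *\<^sub>R h x))"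
    by (rule cSUP_upper2) auto
  then show ?thesis
    by (simp add: schwartz_seminorm_def iter_deriv_def power_abs)
qed

text \<open>Multiplying by \<open>1 + x\<^sup>2\<close> leaves four monomial weights, of degrees 0,
  2, N and N + 2, each controlled by one seminorm. The factor \<open>inverse (1 + x\<^sup>2)\<close>
  is the integrable majorant used throughout.\<close>

lemma weighted_le_seminorms:
  assumes "rapidly_decreasing h"
  shows "(1 + \<bar>x\<bar> ^ N) * norm (h x) \<le>
    (schwartz_seminorm 0 0 h + schwartz_seminorm 2 0 h + schwartz_seminorm N 0 h
      + schwartz_seminorm (N + 2) 0 h) * inverse (1 + x\<^sup>2)"
    (is "_ \<le> ?S * _")
proof -
  have "(1 + \<bar>x\<bar> ^ N) * norm (h x) * (1 + x\<^sup>2) =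
      \<bar>x\<bar> ^ 0 * norm (h x) + \<bar>x\<bar> ^ 2 * norm (h x) + \<bar>x\<bar> ^ N * norm (h x)
      + \<bar>x\<bar> ^ (N + 2) * norm (h x)"
    by (simp add: algebra_simps power_add power2_eq_square)
  also have "\<dots> \<le> ?S"
    by (intro add_mono rapidly_decreasing_le_seminorm assms)
  finally show ?thesis
    by (simp add: divide_inverse [symmetric] pos_le_divide_eq add_pos_nonneg)
qed

lemma integrable_inverse_1_plus_square_lborel:
  "integrable lborel (\<lambda>x::real. inverse (1 + x\<^sup>2))"
  and lborel_integral_inverse_1_plus_square: "(LINT x|lborel. inverse (1 + x\<^sup>2)) = pi"
  using integrable_inverse_1_plus_square LBINT_inverse_1_plus_square
  by (simp_all add: set_integrable_def interval_lebesgue_integral_def set_lebesgue_integral_def)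

text \<open>The product is dominated by a multiple of \<open>inverse (1 + x\<^sup>2)\<close>, whose
  integral is \<pi>. The explicit seminorm bound is what yields continuity of the induced
  distribution.\<close>

lemma
  fixes f h :: "real \<Rightarrow> complex"
  assumes [measurable]: "f \<in> borel_measurable borel" "h \<in> borel_measurable borel"
    and f: "\<And>x. norm (f x) \<le> C * (1 + \<bar>x\<bar> ^ N)"
    and h: "rapidly_decreasing h"
  shows integrable_poly_bounded_mult: "integrable lborel (\<lambda>x. f x * h x)"
    and norm_integral_poly_bounded_mult: "norm (LINT x|lborel. f x * h x) \<le>
      pi * C * (schwartz_seminorm 0 0 h + schwartz_seminorm 2 0 h + schwartz_seminorm N 0 h
        + schwartz_seminorm (N + 2) 0 h)"
proof -
  define S where "S = schwartz_seminorm 0 0 h + schwartz_seminorm 2 0 h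
    + schwartz_seminorm N 0 h + schwartz_seminorm (N + 2) 0 h"
  \<comment> \<open>The sign of \<open>C\<close> is read off from the growth bound at a single
    point.\<close>
  have "0 \<le> C * (1 + \<bar>1\<bar> ^ N)"
    using f [of 1] norm_ge_zero order_trans by blast
  then have C: "0 \<le> C" by (simp add: zero_le_mult_iff)
  have le: "norm (f x * h x) \<le> C * S * inverse (1 + x\<^sup>2)" for x
  proof -
    have "norm (f x * h x) \<le> C * ((1 + \<bar>x\<bar> ^ N) * norm (h x))"
      using mult_right_mono [OF f [of x] norm_ge_zero [of "h x"]]
      by (simp add: norm_mult mult.assoc)
    also have "\<dots> \<le> C * (S * inverse (1 + x\<^sup>2))"
      unfolding S_def by (intro mult_left_mono weighted_le_seminorms h C)
    finally show ?thesis by (simp add: mult.assoc)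
  qed
  have int: "integrable lborel (\<lambda>x. C * S * inverse (1 + x\<^sup>2))"
    by (intro integrable_mult_right integrable_inverse_1_plus_square_lborel)
  show *: "integrable lborel (\<lambda>x. f x * h x)"
    by (rule Bochner_Integration.integrable_bound [OF int])
      (use le in \<open>auto intro!: AE_I2 order_trans [OF _ abs_ge_self]\<close>)
  have "norm (LINT x|lborel. f x * h x) \<le> (LINT x|lborel. C * S * inverse (1 + x\<^sup>2))"
    by (rule Bochner_Integration.integral_norm_bound_integral [OF * int le])
  then show "norm (LINT x|lborel. f x * h x) \<le> pi * C * (schwartz_seminorm 0 0 h + schwartz_seminorm 2 0 h + schwartz_seminorm N 0 h
        + schwartz_seminorm (N + 2) 0 h)"
    unfolding S_def
    by (simp add: lborel_integral_inverse_1_plus_square mult_ac)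
qed

lemma integrable_rapidly_decreasing:
  assumes "h \<in> borel_measurable borel" "rapidly_decreasing h"
  shows "integrable lborel h"
  using integrable_poly_bounded_mult [OF _ assms(1) _ assms(2), of "\<lambda>_. 1" 1 0] by simp

lemma iter_deriv_Suc:
  "iter_deriv (Suc n) \<phi> = (\<lambda>x. vector_derivative (iter_deriv n \<phi>) (at x))"
  by (simp add: iter_deriv_def)

lemma schwartz_iter_deriv:
  assumes "\<phi> \<in> schwartz_space"
  shows "(iter_deriv n \<phi> has_vector_derivative iter_deriv (Suc n) \<phi> x) (at x)"
    and "continuous_on A (iter_deriv n \<phi>)"
    and "iter_deriv n \<phi> \<in> borel_measurable borel"
    and "rapidly_decreasing (iter_deriv n \<phi>)"
proof -
  have d: "iter_deriv n \<phi> differentiable (at x)" for x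
    using assms by (simp add: schwartz_space_def)
  then show "(iter_deriv n \<phi> has_vector_derivative iter_deriv (Suc n) \<phi> x) (at x)"
    by (simp add: iter_deriv_Suc vector_derivative_works)
  have c: "continuous_on UNIV (iter_deriv n \<phi>)"
    using d by (simp add: continuous_at_imp_continuous_on differentiable_imp_continuous_within)
  then show "continuous_on A (iter_deriv n \<phi>)"
    by (rule continuous_on_subset) simp
  show "iter_deriv n \<phi> \<in> borel_measurable borel"
    by (rule borel_measurable_continuous_onI [OF c])
  show "rapidly_decreasing (iter_deriv n \<phi>)"
    using assms by (simp add: schwartz_space_def rapidly_decreasing_def)
qed

lemma iter_deriv_0: "iter_deriv 0 \<phi> = \<phi>"
  by (simp add: iter_deriv_def)

lemmas schwartz_fun = schwartz_iter_deriv(2-4) [where n=0, unfolded iter_deriv_0]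

lemma schwartz_seminorm_nonneg:
  assumes "\<phi> \<in> schwartz_space"
  shows "0 \<le> schwartz_seminorm m n \<phi>"
proof -
  have "0 \<le> \<bar>0\<bar> ^ m * norm (iter_deriv n \<phi> 0)" by simp
  also have "\<dots> \<le> schwartz_seminorm m 0 (iter_deriv n \<phi>)"
    by (rule rapidly_decreasing_le_seminorm [OF schwartz_iter_deriv(4) [OF assms]])
  finally show ?thesis
    by (simp add: schwartz_seminorm_def iter_deriv_0)
qed

lemma tempered_function_poly_bounded:
  assumes meas: "f \<in> borel_measurable borel"
    and f: "\<And>x. norm (f x) \<le> C * (1 + \<bar>x\<bar> ^ N)"
  shows "tempered_function f"
proof -
  have int: "integrable lborel (\<lambda>x. f x * \<phi> x)" if "\<phi> \<in> schwartz_space" for \<phi>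
    using integrable_poly_bounded_mult [OF meas _ f] schwartz_fun [OF that] by blast
  \<comment> \<open>The factor 4 counts the four seminorms of the pairing estimate, each at most the
    full double sum up to N + 2.\<close>
  have "norm (distribution_of f \<phi>) \<le>
      4 * pi * C * (\<Sum>m\<le>N + 2. \<Sum>n\<le>N + 2. schwartz_seminorm m n \<phi>)"
    if \<phi>: "\<phi> \<in> schwartz_space" for \<phi>
  proof -
    define S where "S = (\<Sum>m\<le>N + 2. \<Sum>n\<le>N + 2. schwartz_seminorm m n \<phi>)"
    have le: "schwartz_seminorm m 0 \<phi> \<le> S" if "m \<le> N + 2" for m
    proof -
      have "schwartz_seminorm m 0 \<phi> \<le> (\<Sum>n\<le>N + 2. schwartz_seminorm m n \<phi>)"
        by (rule member_le_sum) (auto simp: schwartz_seminorm_nonneg \<phi>)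
      also have "\<dots> \<le> S"
        unfolding S_def
        by (rule member_le_sum) (use that in \<open>simp_all del: sum.atMost_Suc add: sum_nonneg schwartz_seminorm_nonneg \<phi>\<close>)
      finally show ?thesis .
    qed
    have "0 \<le> C * (1 + \<bar>1\<bar> ^ N)"
      using f [of 1] norm_ge_zero order_trans by blast
    then have C: "0 \<le> C" by (simp add: zero_le_mult_iff)
    have "norm (distribution_of f \<phi>) \<le> pi * C *
        (schwartz_seminorm 0 0 \<phi> + schwartz_seminorm 2 0 \<phi> + schwartz_seminorm N 0 \<phi>
          + schwartz_seminorm (N + 2) 0 \<phi>)"
      unfolding distribution_of_def
      using norm_integral_poly_bounded_mult [OF meas _ f] schwartz_fun [OF \<phi>] by blast
    also have "\<dots> \<le> pi * C * (S + S + S + S)"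
      using C by (intro mult_left_mono add_mono le) auto
    finally show ?thesis unfolding S_def [symmetric] by simp
  qed
  then have "\<exists>C N. \<forall>\<phi>\<in>schwartz_space. norm (distribution_of f \<phi>) \<le>
      C * (\<Sum>m\<le>N. \<Sum>n\<le>N. schwartz_seminorm m n \<phi>)"
    by blast
  moreover have "distribution_of f (\<lambda>x. \<phi> x + \<psi> x) = distribution_of f \<phi> + distribution_of f \<psi>"
    if "\<phi> \<in> schwartz_space" "\<psi> \<in> schwartz_space" for \<phi> \<psi>
    using int [OF that(1)] int [OF that(2)] by (simp add: distribution_of_def distrib_left)
  moreover have "distribution_of f (\<lambda>x. c * \<phi> x) = c * distribution_of f \<phi>" for c \<phi>
    by (simp add: distribution_of_def mult.left_commute [of _ c])
  ultimately show ?thesis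
    using meas int by (simp add: tempered_function_def tempered_distribution_def)
qed

section \<open>Fourier transforms of integrable functions and inversion\<close>

lemma fourier_kernel_measurable [measurable]:
  "(\<lambda>(x, y). exp (\<i> * of_real (x * y))) \<in> borel_measurable (borel \<Otimes>\<^sub>M (borel :: real measure))"
  unfolding case_prod_beta borel_prod
  by (intro borel_measurable_continuous_onI continuous_intros)

lemma fourier_test_measurable:
  assumes [measurable]: "a \<in> borel_measurable borel"
  shows "fourier_test a \<in> borel_measurable borel"
  unfolding fourier_test_def [abs_def] by measurable

lemma norm_fourier_test_le: "norm (fourier_test a x) \<le> (LINT y|lborel. norm (a y))"
proof -
  have "norm (fourier_test a x) \<le> (LINT y|lborel. norm (exp (\<i> * of_real (x * y)) * a y))"
    unfolding fourier_test_def by (rule integral_norm_bound)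
  then show ?thesis by (simp add: norm_mult)
qed

lemma integrable_fourier:
  assumes "integrable lborel a"
  shows "integrable lborel (\<lambda>y. exp (\<i> * of_real (x * y)) * a y)"
proof -
  have [measurable]: "a \<in> borel_measurable borel" using assms by simp
  show ?thesis
    by (rule Bochner_Integration.integrable_bound [OF integrable_norm [OF assms]])
      (auto simp: norm_mult)
qed

text \<open>Fubini for \<open>exp (\<i> * of_real (x * y)) * (a x * b y)\<close>, absolutely
  integrable because the kernel is unimodular. It serves twice: for inversion, and to move truncated
  transforms onto the test function.\<close>

lemma fourier_test_multiplication_formula:
  assumes a: "integrable lborel a" and b: "integrable lborel b"
  shows "(LINT x|lborel. a x * fourier_test b x) = (LINT y|lborel. b y * fourier_test a y)"
proof -
  have [measurable]: "a \<in> borel_measurable borel" "b \<in> borel_measurable borel"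
    using a b by auto
  let ?F = "\<lambda>x y. exp (\<i> * of_real (x * y)) * (a x * b y)"
  have "integrable (lborel \<Otimes>\<^sub>M lborel) (\<lambda>(x, y). a x * b y)"
    by (rule lborel_pair.Fubini_integrable)
      (use a b in \<open>auto simp: norm_mult\<close>)
  then have "integrable (lborel \<Otimes>\<^sub>M lborel) (\<lambda>(x, y). ?F x y)"
    by (rule Bochner_Integration.integrable_bound) (auto simp: norm_mult)
  then have "(LINT y|lborel. LINT x|lborel. ?F x y) = (LINT x|lborel. LINT y|lborel. ?F x y)"
    by (rule lborel_pair.Fubini_integral)
  moreover have "(LINT y|lborel. ?F x y) = a x * fourier_test b x" for x
    by (simp add: fourier_test_def mult.left_commute [of _ "a x"] 
        flip: integral_mult_right_zero)
  moreover have "(LINT x|lborel. ?F x y) = b y * fourier_test a y" for y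
    unfolding fourier_test_def
    by (subst integral_mult_right_zero [symmetric])
       (auto intro!: Bochner_Integration.integral_cong simp: mult_ac)
  ultimately show ?thesis by simp
qed

text \<open>The product \<open>exp (\<i> * of_real (\<gamma> * x)) * \<psi> x\<close> vanishes at
  both infinities, so its derivative integrates to 0 over the line; the two terms of the product
  rule give the identity.\<close>

lemma fourier_test_derivative:
  assumes \<psi>: "\<And>x. (\<psi> has_vector_derivative \<psi>' x) (at x)"
    and int: "integrable lborel \<psi>" "integrable lborel \<psi>'"
    and cont: "continuous_on UNIV \<psi>'"
    and dec: "rapidly_decreasing \<psi>"
  shows "fourier_test \<psi>' \<gamma> = - (\<i> * of_real \<gamma>) * fourier_test \<psi> \<gamma>"
proof -
  define F where "F x = exp (\<i> * of_real (\<gamma> * x)) * \<psi> x" for x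
  define F' where "F' x = exp (\<i> * of_real (\<gamma> * x)) * \<psi>' x
    + \<i> * of_real \<gamma> * (exp (\<i> * of_real (\<gamma> * x)) * \<psi> x)" for x
  have F': "(F has_vector_derivative F' x) (at x)" for x
  proof -
    have "((\<lambda>x. exp (\<i> * (of_real \<gamma> * of_real x))) has_vector_derivative
        \<i> * of_real \<gamma> * exp (\<i> * (of_real \<gamma> * of_real x))) (at x)"
      by (rule has_vector_derivative_real_field) (auto intro!: derivative_eq_intros)
    from has_vector_derivative_mult [OF this \<psi>] show ?thesis
      unfolding F_def [abs_def] F'_def by (simp add: mult_ac)
  qed
  have "continuous_on UNIV \<psi>"
    using \<psi> continuous_at_imp_continuous_on has_vector_derivative_continuous by blast
  then have "continuous_on UNIV F'"
    unfolding F'_def using cont by (intro continuous_intros)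
  then have cF': "isCont F' x" for x
    by (simp add: continuous_on_eq_continuous_at)
  have iF': "integrable lborel F'"
    unfolding F'_def
    by (intro Bochner_Integration.integrable_add integrable_mult_right integrable_fourier int)
  have lim: "(F \<longlongrightarrow> 0) at_infinity"
  proof (rule Lim_null_comparison)
    let ?M = "schwartz_seminorm 1 0 \<psi>"
    have "norm (F x) \<le> ?M / norm x" if "norm x \<ge> 1" for x
      using rapidly_decreasing_le_seminorm [OF dec, of x 1] that
      by (simp add: F_def norm_mult field_simps)
    then show "\<forall>\<^sub>F x in at_infinity. norm (F x) \<le> ?M / norm x"
      unfolding eventually_at_infinity by blast
    show "((\<lambda>x::real. ?M / norm x) \<longlongrightarrow> 0) at_infinity"
      by (rule real_tendsto_divide_at_top [OF tendsto_const filterlim_norm_at_top])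
  qed
  have "(LBINT x=-\<infinity>..\<infinity>. F' x) = 0 - 0"
  proof (rule interval_integral_FTC_integrable)
    show "((F \<circ> real_of_ereal) \<longlongrightarrow> 0) (at_right (-\<infinity>))"
      "((F \<circ> real_of_ereal) \<longlongrightarrow> 0) (at_left \<infinity>)"
      using lim by (auto simp: ereal_tendsto_simps at_infinity_def
        intro: filterlim_mono [OF lim] at_top_le_at_infinity at_bot_le_at_infinity)
  qed (use F' cF' iF' in \<open>auto simp: set_integrable_def\<close>)
  then have "(LINT x|lborel. F' x) = 0"
    by (simp add: interval_lebesgue_integral_def set_lebesgue_integral_def)
  moreover have "(LINT x|lborel. F' x) = fourier_test \<psi>' \<gamma> + \<i> * of_real \<gamma> * fourier_test \<psi> \<gamma>"
    unfolding F'_def fourier_test_def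
    by (simp only: Bochner_Integration.integral_add integrable_mult_right integrable_fourier int
        integral_mult_right_zero)
  ultimately show ?thesis
    by (simp add: add_eq_0_iff)
qed

lemma schwartz_integrable_iter_deriv:
  assumes "\<phi> \<in> schwartz_space"
  shows "integrable lborel (iter_deriv n \<phi>)"
  by (intro integrable_rapidly_decreasing schwartz_iter_deriv assms)

lemma fourier_test_iter_deriv:
  assumes "\<phi> \<in> schwartz_space"
  shows "fourier_test (iter_deriv n \<phi>) \<gamma> = (- (\<i> * of_real \<gamma>)) ^ n * fourier_test \<phi> \<gamma>"
proof (induction n)
  case 0
  show ?case by (simp add: iter_deriv_0)
next
  case (Suc n)
  show ?case
    using fourier_test_derivative [where \<psi>="iter_deriv n \<phi>" and \<psi>'="iter_deriv (Suc n) \<phi>"]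
      schwartz_iter_deriv [OF assms] schwartz_integrable_iter_deriv [OF assms]
    by (simp add: Suc)
qed

text \<open>Up to a unimodular factor, the weight \<open>x ^ m\<close> turns the transform into that
  of the m-th derivative, which is bounded by an L1 norm. This decay lets the transform be paired
  with functions of polynomial growth.\<close>

lemma rapidly_decreasing_fourier_test:
  assumes "\<phi> \<in> schwartz_space"
  shows "rapidly_decreasing (fourier_test \<phi>)"
  unfolding rapidly_decreasing_def
proof
  fix m
  have "norm (x ^ m *\<^sub>R fourier_test \<phi> x) = norm (fourier_test (iter_deriv m \<phi>) x)" for x
    by (simp add: fourier_test_iter_deriv assms norm_mult norm_power power_abs)
  then show "bounded (range (\<lambda>x. x ^ m *\<^sub>R fourier_test \<phi> x))"
    unfolding bounded_iff
    by (auto intro!: exI [of _ "LINT y|lborel. norm (iter_deriv m \<phi> y)"] norm_fourier_test_le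
        simp del: norm_scaleR)
qed

text \<open>This is the characteristic function exp(-t^2/2) of the standard normal law, rewritten
  through the density itself.\<close>

lemma fourier_test_std_normal_density:
  "fourier_test (\<lambda>x. of_real (std_normal_density x)) t = of_real (sqrt (2 * pi) * std_normal_density t)"
proof -
  have "fourier_test (\<lambda>x. of_real (std_normal_density x)) t = char std_normal_distribution t"
    unfolding fourier_test_def char_def
    by (subst integral_density) (auto simp: scaleR_conv_of_real mult.commute)
  then show ?thesis
    unfolding char_std_normal_distribution by (simp add: std_normal_density_def)
qed

text \<open>Inversion by Gaussian regularisation: the multiplication formula turns the Fourier integral
  damped by a wide Gaussian into the average of \<open>\<phi>\<close> against a narrow one.\<close>

lemma fourier_inversion:
  fixes \<phi> :: "real \<Rightarrow> complex"
  assumes int: "integrable lborel \<phi>" and cont: "continuous_on UNIV \<phi>"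
    and bnd: "\<And>x. norm (\<phi> x) \<le> B" and int': "integrable lborel (fourier_test \<phi>)"
  shows "fourier_test (\<lambda>x. fourier_test \<phi> (- x)) \<gamma> = 2 * pi * \<phi> \<gamma>"
proof -
  let ?D = "\<lambda>x. complex_of_real (std_normal_density x)"
  \<comment> \<open>The modulation centres the transform of \<open>e n\<close> at \<gamma>. The
    dilation makes the damping flatten to the constant \<open>?D 0\<close> while that transform
    concentrates; \<open>Suc n\<close> keeps the scale nonzero.\<close>
  define e where "e n x = exp (\<i> * of_real (- \<gamma> * x)) * ?D (x / real (Suc n))" for n x
  have [measurable]: "\<phi> \<in> borel_measurable borel"
    using int by simp
  have [measurable]: "fourier_test \<phi> \<in> borel_measurable borel"
    using int' by simp
  have D: "integrable lborel ?D"
    by simp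
  have e: "integrable lborel (e n)" for n
    unfolding e_def using lborel_integrable_real_affine [OF D, of "1 / real (Suc n)" 0]
    by (intro integrable_fourier) simp
  have D_le: "std_normal_density x \<le> 1 / sqrt (2 * pi)" for x
    by (simp add: std_normal_density_def divide_right_mono)
  have fe: "fourier_test (e n) y = of_real (real (Suc n) * (sqrt (2 * pi)
      * std_normal_density (real (Suc n) * (y - \<gamma>))))" for n y
  proof -
    have "fourier_test (e n) y = (LINT x|lborel. exp (\<i> * of_real ((y - \<gamma>) * x)) * ?D (x / real (Suc n)))"
    proof -
      have "exp (\<i> * of_real (y * x)) * exp (\<i> * of_real (- \<gamma> * x)) = exp (\<i> * of_real ((y - \<gamma>) * x))" for x
        unfolding exp_add [symmetric] by (rule arg_cong [of _ _ exp]) (simp add: algebra_simps)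
      then show ?thesis
        unfolding fourier_test_def e_def by (simp only: mult.assoc [symmetric])
    qed
    also have "\<dots> = real (Suc n) *\<^sub>R (LINT x|lborel. exp (\<i> * of_real ((real (Suc n) * (y - \<gamma>)) * x)) * ?D x)"
      by (subst lborel_integral_real_affine [where c="real (Suc n)" and t=0])
        (auto simp: mult_ac)
    also have "\<dots> = real (Suc n) *\<^sub>R of_real (sqrt (2 * pi) * std_normal_density (real (Suc n) * (y - \<gamma>)))"
      using fourier_test_std_normal_density [of "real (Suc n) * (y - \<gamma>)"]
      unfolding fourier_test_def by simp
    finally show ?thesis
      by (simp add: scaleR_conv_of_real)
  qed
  \<comment> \<open>The substitution y = \<gamma> + z/(n+1) undoes the concentration, and its
    Jacobian cancels the factor n+1 of \<open>fe\<close>.\<close>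
  have eq: "(LINT x|lborel. e n x * fourier_test \<phi> x) =
      of_real (sqrt (2 * pi)) * (LINT z|lborel. \<phi> (\<gamma> + z / real (Suc n)) * ?D z)" for n
  proof -
    have "(LINT x|lborel. e n x * fourier_test \<phi> x) = (LINT y|lborel. \<phi> y * fourier_test (e n) y)"
      by (rule fourier_test_multiplication_formula [OF e int])
    also have "\<dots> = (1 / real (Suc n)) *\<^sub>R (LINT z|lborel. \<phi> (\<gamma> + z / real (Suc n)) *
        fourier_test (e n) (\<gamma> + z / real (Suc n)))"
      by (subst lborel_integral_real_affine [where c="1 / real (Suc n)" and t=\<gamma>]) auto
    also have "\<dots> = (1 / real (Suc n)) *\<^sub>R (LINT z|lborel. of_real (real (Suc n) * sqrt (2 * pi)) *
        (\<phi> (\<gamma> + z / real (Suc n)) * ?D z))"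
      by (simp only: fe) (simp add: mult_ac)
    also have "\<dots> = (1 / real (Suc n)) *\<^sub>R (of_real (real (Suc n) * sqrt (2 * pi)) *
        (LINT z|lborel. \<phi> (\<gamma> + z / real (Suc n)) * ?D z))"
      by (simp only: integral_mult_right_zero)
    finally show ?thesis
      by (simp add: scaleR_conv_of_real field_simps del: of_nat_Suc)
  qed
  have small: "(\<lambda>n. c / real (Suc n)) \<longlonglongrightarrow> 0" for c :: real
    using LIMSEQ_inverse_real_of_nat [THEN tendsto_mult_left, of c] by (simp add: divide_inverse)
  \<comment> \<open>First evaluation of the limit: the damping factor converges pointwise and stays
    below the peak 1/sqrt(2\<pi>) of the density, so integrability of
    \<open>fourier_test \<phi>\<close> gives domination.\<close>
  have "(\<lambda>n. LINT x|lborel. e n x * fourier_test \<phi> x) \<longlonglongrightarrow>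
      (LINT x|lborel. (exp (\<i> * of_real (- \<gamma> * x)) * ?D 0) * fourier_test \<phi> x)"
  proof (rule integral_dominated_convergence [where w="\<lambda>x. 1 / sqrt (2 * pi) * norm (fourier_test \<phi> x)"])
    show "AE x in lborel. (\<lambda>n. e n x * fourier_test \<phi> x) \<longlonglongrightarrow>
        exp (\<i> * of_real (- \<gamma> * x)) * ?D 0 * fourier_test \<phi> x"
    proof (intro AE_I2 tendsto_mult tendsto_const)
      fix x
      have "isCont std_normal_density 0"
        unfolding std_normal_density_def [abs_def] by (intro continuous_intros) auto
      then have "(\<lambda>n. std_normal_density (x / real (Suc n))) \<longlonglongrightarrow> std_normal_density 0"
        by (rule isCont_tendsto_compose [OF _ small])
      then show "(\<lambda>n. e n x) \<longlonglongrightarrow> exp (\<i> * of_real (- \<gamma> * x)) * ?D 0"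
        unfolding e_def by (intro tendsto_intros)
    qed
    show "AE x in lborel. norm (e n x * fourier_test \<phi> x) \<le> 1 / sqrt (2 * pi) * norm (fourier_test \<phi> x)" for n
      unfolding e_def norm_mult
      by (intro AE_I2 mult_right_mono) (use D_le in \<open>auto simp del: of_nat_Suc\<close>)
  qed (use int' in \<open>auto simp: e_def\<close>)
  \<comment> \<open>Second evaluation, through \<open>eq\<close>: continuity of \<phi> at \<gamma>
    gives the pointwise limit, boundedness of \<phi> the domination.\<close>
  moreover have "(\<lambda>n. LINT x|lborel. e n x * fourier_test \<phi> x) \<longlonglongrightarrow>
      of_real (sqrt (2 * pi)) * (LINT z|lborel. \<phi> \<gamma> * ?D z)"
    unfolding eq
  proof (intro tendsto_mult tendsto_const,
      rule integral_dominated_convergence [where w="\<lambda>z. B * std_normal_density z"])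
    show "AE z in lborel. (\<lambda>n. \<phi> (\<gamma> + z / real (Suc n)) * ?D z) \<longlonglongrightarrow> \<phi> \<gamma> * ?D z"
    proof (intro AE_I2 tendsto_mult tendsto_const)
      fix z
      have "isCont \<phi> \<gamma>"
        using cont by (simp add: continuous_on_eq_continuous_at)
      moreover have "(\<lambda>n. \<gamma> + z / real (Suc n)) \<longlonglongrightarrow> \<gamma>"
        using tendsto_add [OF tendsto_const small] by fastforce
      ultimately show "(\<lambda>n. \<phi> (\<gamma> + z / real (Suc n))) \<longlonglongrightarrow> \<phi> \<gamma>"
        by (rule isCont_tendsto_compose)
    qed
    show "AE z in lborel. norm (\<phi> (\<gamma> + z / real (Suc n)) * ?D z) \<le> B * std_normal_density z" for n
      by (auto simp: norm_mult intro!: AE_I2 mult_right_mono bnd)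
  qed auto
  ultimately have "(LINT x|lborel. (exp (\<i> * of_real (- \<gamma> * x)) * ?D 0) * fourier_test \<phi> x) =
      of_real (sqrt (2 * pi)) * (LINT z|lborel. \<phi> \<gamma> * ?D z)"
    by (rule LIMSEQ_unique)
  moreover have "(LINT x|lborel. (exp (\<i> * of_real (- \<gamma> * x)) * ?D 0) * fourier_test \<phi> x) =
      (LINT x|lborel. ?D 0 * (exp (\<i> * of_real (\<gamma> * x)) * fourier_test \<phi> (- x)))"
    by (subst lborel_integral_real_affine [where c="-1" and t=0]) (auto simp: mult_ac)
  moreover have "(LINT z|lborel. \<phi> \<gamma> * ?D z) = \<phi> \<gamma>"
    by simp
  ultimately have "of_real (1 / sqrt (2 * pi)) * fourier_test (\<lambda>x. fourier_test \<phi> (- x)) \<gamma> =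
      of_real (sqrt (2 * pi)) * \<phi> \<gamma>"
    by (simp only: integral_mult_right_zero fourier_test_def std_normal_density_def) simp
  then have "of_real (sqrt (2 * pi) * (1 / sqrt (2 * pi))) * fourier_test (\<lambda>x. fourier_test \<phi> (- x)) \<gamma> =
      of_real (sqrt (2 * pi) * sqrt (2 * pi)) * \<phi> \<gamma>"
    by (simp only: of_real_mult mult.assoc)
  then show ?thesis by simp
qed

section \<open>From truncated inverse Fourier integrals to the distributional transform\<close>

text \<open>For each cutoff the desired identity holds by the multiplication formula and inversion.
  The polynomial bound, uniform in the cutoff, then allows dominated convergence on the side of
  \<open>f\<close>; the bound on \<open>g\<close> does so on the other.\<close>

lemma has_fourier_transform_LIMSEQ:
  fixes f g :: "real \<Rightarrow> complex"
  assumes g: "g \<in> borel_measurable borel" "\<And>\<gamma>. norm (g \<gamma>) \<le> 1"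
    and lim: "\<And>x. (\<lambda>n. fourier_test (\<lambda>\<gamma>. indicator {- real n..real n} \<gamma> * g \<gamma>) (- x) / (2 * pi))
      \<longlonglongrightarrow> f x"
    and bnd: "\<And>n x. norm (fourier_test (\<lambda>\<gamma>. indicator {- real n..real n} \<gamma> * g \<gamma>) (- x) / (2 * pi))
      \<le> C * (1 + \<bar>x\<bar> ^ N)"
  shows "has_fourier_transform f g"
proof -
  define a where "a n \<gamma> = indicator {- real n..real n} \<gamma> * g \<gamma>" for n \<gamma>
  have [measurable]: "g \<in> borel_measurable borel" by fact
  have [measurable]: "a n \<in> borel_measurable borel" for n
    unfolding a_def [abs_def] by measurable
  have ia: "integrable lborel (a n)" for n
  proof (rule Bochner_Integration.integrable_bound)
    show "integrable lborel (indicator {- real n..real n} :: real \<Rightarrow> real)"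
      by simp
    show "AE x in lborel. norm (a n x) \<le> norm (indicator {- real n..real n} x :: real)"
      using g(2) by (auto simp: a_def norm_mult split: split_indicator)
  qed auto
  define F where "F n x = fourier_test (a n) (- x) / (2 * pi)" for n x
  have [measurable]: "fourier_test (a n) \<in> borel_measurable borel" for n
    by (rule fourier_test_measurable) simp
  have Fm [measurable]: "F n \<in> borel_measurable borel" for n
    unfolding F_def [abs_def] by measurable
  have F_lim: "(\<lambda>n. F n x) \<longlonglongrightarrow> f x" and F_bnd: "norm (F n x) \<le> C * (1 + \<bar>x\<bar> ^ N)" for n x
    using lim bnd unfolding F_def a_def by auto
  have fm [measurable]: "f \<in> borel_measurable borel"
    by (rule borel_measurable_LIMSEQ_metric [OF Fm F_lim])
  have f_bnd: "norm (f x) \<le> C * (1 + \<bar>x\<bar> ^ N)" for x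
    by (rule LIMSEQ_le_const2 [OF tendsto_norm [OF F_lim]]) (use F_bnd in auto)
  have "tempered_function f"
    by (rule tempered_function_poly_bounded [OF fm f_bnd])
  moreover have "tempered_function g"
    by (rule tempered_function_poly_bounded [where C=1 and N=0, OF g(1)])
      (simp add: order_trans [OF g(2)])
  moreover have "fourier_distribution (distribution_of f) \<phi> = distribution_of g \<phi>"
    if \<phi>: "\<phi> \<in> schwartz_space" for \<phi>
  proof -
    note schwartz_fun(2) [OF \<phi>, measurable]
    note i\<phi> = integrable_rapidly_decreasing [OF schwartz_fun(2,3) [OF \<phi>]]
    have m [measurable]: "fourier_test \<phi> \<in> borel_measurable borel"
      by (rule fourier_test_measurable) simp
    note d = rapidly_decreasing_fourier_test [OF \<phi>]
    note i = integrable_rapidly_decreasing [OF m d]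
    have "norm (\<phi> x) \<le> schwartz_seminorm 0 0 \<phi>" for x
      using rapidly_decreasing_le_seminorm [OF schwartz_fun(3) [OF \<phi>], of x 0] by simp
    then have inv: "fourier_test (\<lambda>x. fourier_test \<phi> (- x)) \<gamma> = 2 * pi * \<phi> \<gamma>" for \<gamma>
      by (intro fourier_inversion [OF i\<phi> schwartz_fun(1) [OF \<phi>] _ i])
    have i': "integrable lborel (\<lambda>x. fourier_test \<phi> (- x))"
      using lborel_integrable_real_affine [OF i, of "-1" 0] by simp
    \<comment> \<open>Reflecting x moves the sign onto \<open>fourier_test \<phi>\<close>; after the
      multiplication formula the transform acts on the reflected transform, and inversion produces a
      2\<pi> that cancels the normalisation of \<open>F n\<close>.\<close>
    have "(LINT x|lborel. F n x * fourier_test \<phi> x) = (LINT \<gamma>|lborel. a n \<gamma> * \<phi> \<gamma>)" for n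
    proof -
      have "(LINT x|lborel. F n x * fourier_test \<phi> x) =
          (LINT x|lborel. (fourier_test \<phi> (- x) * fourier_test (a n) x) / (2 * pi))"
        unfolding F_def
        by (subst lborel_integral_real_affine [where c="-1" and t=0]) (auto simp: mult_ac)
      also have "\<dots> = (LINT \<gamma>|lborel. a n \<gamma> * fourier_test (\<lambda>x. fourier_test \<phi> (- x)) \<gamma>) / (2 * pi)"
        by (simp only: integral_divide_zero fourier_test_multiplication_formula [OF i' ia])
      finally show ?thesis
        by (simp add: inv mult.left_commute [of _ "2 * complex_of_real pi"])
    qed
    moreover have "(\<lambda>n. LINT x|lborel. F n x * fourier_test \<phi> x) \<longlonglongrightarrow> (LINT x|lborel. f x * fourier_test \<phi> x)"
    \<comment> \<open>The majorant is written as the norm of a product so that its integrability is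
      again the pairing estimate for polynomial growth.\<close>
    proof (rule integral_dominated_convergence
        [where w="\<lambda>x. norm (of_real (C * (1 + \<bar>x\<bar> ^ N)) * fourier_test \<phi> x)"])
      have "norm (complex_of_real (C * (1 + \<bar>x\<bar> ^ N))) \<le> C * (1 + \<bar>x\<bar> ^ N)" for x
        unfolding norm_of_real using f_bnd [of x] norm_ge_zero order_trans
        by (metis abs_of_nonneg order_refl)
      then show "integrable lborel (\<lambda>x. norm (of_real (C * (1 + \<bar>x\<bar> ^ N)) * fourier_test \<phi> x))"
        by (intro integrable_norm integrable_poly_bounded_mult [OF _ m _ d]) auto
      show "AE x in lborel. norm (F n x * fourier_test \<phi> x) \<le>
          norm (of_real (C * (1 + \<bar>x\<bar> ^ N)) * fourier_test \<phi> x)" for n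
        unfolding norm_mult norm_of_real
        by (intro AE_I2 mult_right_mono order_trans [OF F_bnd]) auto
    qed (auto intro!: tendsto_intros F_lim)
    moreover have "(\<lambda>n. LINT \<gamma>|lborel. a n \<gamma> * \<phi> \<gamma>) \<longlonglongrightarrow> (LINT \<gamma>|lborel. g \<gamma> * \<phi> \<gamma>)"
    proof (rule integral_dominated_convergence [where w="\<lambda>\<gamma>. norm (\<phi> \<gamma>)"])
      show "AE \<gamma> in lborel. (\<lambda>n. a n \<gamma> * \<phi> \<gamma>) \<longlonglongrightarrow> g \<gamma> * \<phi> \<gamma>"
      proof (intro AE_I2 tendsto_mult tendsto_const tendsto_eventually)
        fix \<gamma> :: real
        obtain k :: nat where "\<bar>\<gamma>\<bar> \<le> real k" using real_arch_simple by blast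
        then have "a n \<gamma> = g \<gamma>" if "k \<le> n" for n
          using that by (auto simp: a_def indicator_def)
        then show "\<forall>\<^sub>F n in sequentially. a n \<gamma> = g \<gamma>"
          unfolding eventually_sequentially by blast
      qed
      show "AE \<gamma> in lborel. norm (a n \<gamma> * \<phi> \<gamma>) \<le> norm (\<phi> \<gamma>)" for n
        using g(2) by (auto simp: a_def norm_mult indicator_def mult_left_le_one_le)
    qed (use i\<phi> in auto)
    ultimately show ?thesis
      unfolding fourier_distribution_def distribution_of_def
      by (metis (no_types, lifting) LIMSEQ_unique ext)
  qed
  ultimately show ?thesis by (simp add: has_fourier_transform_def)
qed

section \<open>The truncated Airy integral\<close>

text \<open>Integration by parts: cos \<theta> = (sin \<theta> / \<theta>')' + sin \<theta> *
  \<theta>''/\<theta>'^2. The boundary terms cost at most 1/\<theta>'(a) + 1/\<theta>'(b). Since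
  \<theta>'' \<ge> 0, the remainder is dominated by the derivative of -1/\<theta>' and costs at most
  1/\<theta>'(a) - 1/\<theta>'(b).\<close>

lemma van_der_Corput_cos:
  fixes \<theta> \<theta>' \<theta>'' :: "real \<Rightarrow> real"
  assumes ab: "a \<le> b"
    and d1: "\<And>s. s \<in> {a..b} \<Longrightarrow> (\<theta> has_real_derivative \<theta>' s) (at s within {a..b})"
    and d2: "\<And>s. s \<in> {a..b} \<Longrightarrow> (\<theta>' has_real_derivative \<theta>'' s) (at s within {a..b})"
    and pos: "\<And>s. s \<in> {a..b} \<Longrightarrow> 0 < \<theta>' s"
    and conv: "\<And>s. s \<in> {a..b} \<Longrightarrow> 0 \<le> \<theta>'' s"
  shows "\<bar>integral {a..b} (\<lambda>s. cos (\<theta> s))\<bar> \<le> 2 / \<theta>' a"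
proof -
  define H where "H s = \<theta>'' s / (\<theta>' s)\<^sup>2" for s
  define G where "G s = sin (\<theta> s) / \<theta>' s" for s
  have "continuous_on {a..b} \<theta>"
    by (rule DERIV_continuous_on [OF d1])
  then have cos: "(\<lambda>s. cos (\<theta> s)) integrable_on {a..b}"
    by (intro integrable_continuous_interval continuous_intros)
  have H: "(H has_integral (- (1 / \<theta>' b) - - (1 / \<theta>' a))) {a..b}"
  proof (rule fundamental_theorem_of_calculus [OF ab])
    fix s assume s: "s \<in> {a..b}"
    show "((\<lambda>s. - (1 / \<theta>' s)) has_vector_derivative H s) (at s within {a..b})"
      unfolding has_real_derivative_iff_has_vector_derivative [symmetric] H_def
      using pos [OF s] by (auto intro!: derivative_eq_intros d2 s simp: power2_eq_square)
  qed
  have G: "((\<lambda>s. cos (\<theta> s) - sin (\<theta> s) * H s) has_integral (G b - G a)) {a..b}"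
  proof (rule fundamental_theorem_of_calculus [OF ab])
    fix s assume s: "s \<in> {a..b}"
    show "(G has_vector_derivative cos (\<theta> s) - sin (\<theta> s) * H s) (at s within {a..b})"
      unfolding has_real_derivative_iff_has_vector_derivative [symmetric] H_def G_def
      using pos [OF s]
      by (auto intro!: derivative_eq_intros d1 d2 s simp: power2_eq_square field_simps)
  qed
  \<comment> \<open>\<theta>'' is not assumed continuous, so integrability of the remainder is
    obtained as a difference of two integrable functions.\<close>
  have "((\<lambda>s. cos (\<theta> s) - (cos (\<theta> s) - sin (\<theta> s) * H s)) has_integral
      (integral {a..b} (\<lambda>s. cos (\<theta> s)) - (G b - G a))) {a..b}"
    by (intro has_integral_diff integrable_integral cos G)
  then have SH: "((\<lambda>s. sin (\<theta> s) * H s) has_integral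
      (integral {a..b} (\<lambda>s. cos (\<theta> s)) - (G b - G a))) {a..b}"
    by simp
  have "\<bar>sin (\<theta> s) * H s\<bar> \<le> H s" if "s \<in> {a..b}" for s
  proof -
    have "0 \<le> H s" using conv [OF that] by (simp add: H_def)
    then show ?thesis by (simp add: abs_mult mult_left_le_one_le)
  qed
  then have "norm (integral {a..b} (\<lambda>s. cos (\<theta> s)) - (G b - G a)) \<le> - (1 / \<theta>' b) - - (1 / \<theta>' a)"
    unfolding integral_unique [OF SH, symmetric] integral_unique [OF H, symmetric]
    by (intro integral_norm_bound_integral has_integral_integrable [OF SH]
        has_integral_integrable [OF H]) auto
  moreover have G_le: "\<bar>G s\<bar> \<le> 1 / \<theta>' s" if "s \<in> {a..b}" for s
    using pos [OF that] by (simp add: G_def divide_right_mono)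
  moreover have "\<bar>G a\<bar> \<le> 1 / \<theta>' a" "\<bar>G b\<bar> \<le> 1 / \<theta>' b"
    using ab by (simp_all add: G_le)
  moreover have "2 / \<theta>' a = 1 / \<theta>' a + 1 / \<theta>' a" by simp
  ultimately show ?thesis
    unfolding real_norm_def by linarith
qed

section \<open>Convergence and growth of the Airy integral\<close>

definition airy_partial :: "real \<Rightarrow> real \<Rightarrow> real \<Rightarrow> real" where
  "airy_partial \<alpha> x R = integral {0..R} (\<lambda>s. cos (s * x + s powr \<alpha> / \<alpha>))"

lemma airy_integrand_integrable:
  assumes "\<alpha> > 1" "0 \<le> a"
  shows "(\<lambda>s::real. cos (s * x + s powr \<alpha> / \<alpha>)) integrable_on {a..b}"
  using assms by (intro integrable_continuous_interval continuous_intros continuous_on_powr') auto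

text \<open>The threshold is the point where s^(\<alpha>-1) reaches 1 + |x|. From there on the phase
  derivative x + s^(\<alpha>-1) is at least 1 and increasing, so the van der Corput estimate
  applies.\<close>

lemma airy_partial_diff_bound:
  assumes \<alpha>: "\<alpha> > 1" and a: "(1 + \<bar>x\<bar>) powr (1 / (\<alpha> - 1)) \<le> a" "a \<le> b"
  shows "\<bar>airy_partial \<alpha> x b - airy_partial \<alpha> x a\<bar> \<le> 2 / (x + a powr (\<alpha> - 1))"
    and "1 \<le> x + a powr (\<alpha> - 1)"
proof -
  have "0 < (1 + \<bar>x\<bar>) powr (1 / (\<alpha> - 1))" by simp
  then have a0: "0 < a" using a by linarith
  have "1 + \<bar>x\<bar> = ((1 + \<bar>x\<bar>) powr (1 / (\<alpha> - 1))) powr (\<alpha> - 1)"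
    using \<alpha> by (simp add: powr_powr)
  also have "\<dots> \<le> a powr (\<alpha> - 1)"
    using \<alpha> a by (intro powr_mono2) auto
  finally show 1: "1 \<le> x + a powr (\<alpha> - 1)" by linarith
  have pos: "0 < x + s powr (\<alpha> - 1)" if "s \<in> {a..b}" for s
  proof -
    have "a powr (\<alpha> - 1) \<le> s powr (\<alpha> - 1)"
      using that \<alpha> a0 by (intro powr_mono2) auto
    then show ?thesis using 1 by linarith
  qed
  have "integral {0..b} (\<lambda>s. cos (s * x + s powr \<alpha> / \<alpha>)) =
      airy_partial \<alpha> x a + integral {a..b} (\<lambda>s. cos (s * x + s powr \<alpha> / \<alpha>))"
    unfolding airy_partial_def
    by (rule Henstock_Kurzweil_Integration.integral_combine [symmetric])
      (use a a0 airy_integrand_integrable [OF \<alpha>] in auto)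
  then have "airy_partial \<alpha> x b - airy_partial \<alpha> x a =
      integral {a..b} (\<lambda>s. cos (s * x + s powr \<alpha> / \<alpha>))"
    by (simp add: airy_partial_def)
  also have "\<bar>\<dots>\<bar> \<le> 2 / (x + a powr (\<alpha> - 1))"
  proof (rule van_der_Corput_cos [where \<theta>''="\<lambda>s. (\<alpha> - 1) * s powr (\<alpha> - 2)"])
    fix s assume s: "s \<in> {a..b}"
    then have "0 < s" using a0 by auto
    then show "((\<lambda>s. s * x + s powr \<alpha> / \<alpha>) has_real_derivative x + s powr (\<alpha> - 1)) (at s within {a..b})"
      using \<alpha> by (auto intro!: derivative_eq_intros)
    show "((\<lambda>s. x + s powr (\<alpha> - 1)) has_real_derivative (\<alpha> - 1) * s powr (\<alpha> - 2)) (at s within {a..b})"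
      using \<alpha> \<open>0 < s\<close> by (auto intro!: derivative_eq_intros)
  qed (use a pos \<alpha> in auto)
  finally show "\<bar>airy_partial \<alpha> x b - airy_partial \<alpha> x a\<bar> \<le> 2 / (x + a powr (\<alpha> - 1))" .
qed

text \<open>Shows that the \<open>Lim\<close> in \<open>Airy_gen\<close> is a genuine limit: the
  tail estimate tends to 0 as the lower cutoff grows.\<close>

lemma airy_partial_tendsto:
  assumes \<alpha>: "\<alpha> > 1"
  shows "(airy_partial \<alpha> x \<longlongrightarrow> pi * Airy_gen \<alpha> x) at_top"
proof -
  define K where "K = (1 + \<bar>x\<bar>) powr (1 / (\<alpha> - 1))"
  define r where "r a = 2 / (x + a powr (\<alpha> - 1))" for a
  have bnd: "\<bar>airy_partial \<alpha> x b - airy_partial \<alpha> x a\<bar> \<le> r a" if "K \<le> a" "a \<le> b" for a b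
    using airy_partial_diff_bound(1) [OF \<alpha>] that by (simp add: K_def r_def)
  have "filterlim (\<lambda>a. a powr (\<alpha> - 1)) at_top at_top"
    using \<alpha> by real_asymp
  then have "filterlim (\<lambda>a. x + a powr (\<alpha> - 1)) at_top at_top"
    by (rule filterlim_tendsto_add_at_top [OF tendsto_const])
  then have r0: "(r \<longlongrightarrow> 0) at_top"
    unfolding r_def [abs_def] by (rule real_tendsto_divide_at_top [OF tendsto_const])
  have "Cauchy (\<lambda>n. airy_partial \<alpha> x (real n))"
  proof (rule metric_CauchyI)
    fix e :: real assume "0 < e"
    then have "\<forall>\<^sub>F a in at_top. K \<le> a \<and> r a < e / 2"
      using order_tendstoD(2) [OF r0, of "e / 2"] by (auto intro: eventually_conj)
    then obtain a where "K \<le> a" and a: "\<And>b. a \<le> b \<Longrightarrow> r b < e / 2 \<and> K \<le> b"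
      unfolding eventually_at_top_linorder by auto
    obtain M :: nat where M: "a \<le> real M" using real_arch_simple by blast
    have "\<bar>airy_partial \<alpha> x (real m) - airy_partial \<alpha> x (real M)\<bar> < e / 2" if "M \<le> m" for m
      using bnd [of "real M" "real m"] a [OF M] that by auto
    then show "\<exists>M. \<forall>m\<ge>M. \<forall>n\<ge>M. dist (airy_partial \<alpha> x (real m)) (airy_partial \<alpha> x (real n)) < e"
      by (intro exI [of _ M]) (auto simp: dist_real_def, smt (verit) field_sum_of_halves)
  qed
  then obtain L where L: "(\<lambda>n. airy_partial \<alpha> x (real n)) \<longlonglongrightarrow> L"
    using Cauchy_convergent convergent_def by blast
  \<comment> \<open>Completeness gave the limit along integer cutoffs; letting the upper cutoff tend
    to infinity in the tail estimate extends it to real ones.\<close>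
  have "\<bar>L - airy_partial \<alpha> x R\<bar> \<le> r R" if "K \<le> R" for R
  proof (rule LIMSEQ_le_const2)
    show "(\<lambda>n. \<bar>airy_partial \<alpha> x (real n) - airy_partial \<alpha> x R\<bar>) \<longlonglongrightarrow> \<bar>L - airy_partial \<alpha> x R\<bar>"
      by (intro tendsto_intros L)
    obtain M :: nat where "R \<le> real M" using real_arch_simple by blast
    then show "\<exists>M. \<forall>n\<ge>M. \<bar>airy_partial \<alpha> x (real n) - airy_partial \<alpha> x R\<bar> \<le> r R"
      by (intro exI [of _ M]) (auto intro!: bnd that)
  qed
  then have "\<forall>\<^sub>F R in at_top. norm (airy_partial \<alpha> x R - L) \<le> r R"
    unfolding eventually_at_top_linorder by (intro exI [of _ K]) (auto simp: abs_minus_commute)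
  from Lim_null_comparison [OF this r0] have lim: "(airy_partial \<alpha> x \<longlongrightarrow> L) at_top"
    by (simp add: LIM_zero_iff)
  then have "Lim at_top (airy_partial \<alpha> x) = L"
    by (intro tendsto_Lim) auto
  then show ?thesis
    using lim by (simp add: Airy_gen_def airy_partial_def [abs_def])
qed

text \<open>Split at the threshold \<open>K\<close>: up to \<open>K\<close> the integral is at most
  its length, beyond \<open>K\<close> it changes by at most 2. \<open>K\<close> itself grows like a
  power of |x|.\<close>

lemma airy_partial_bound:
  assumes \<alpha>: "\<alpha> > 1"
  obtains C N where "\<And>x R. 0 \<le> R \<Longrightarrow> \<bar>airy_partial \<alpha> x R\<bar> \<le> C * (1 + \<bar>x\<bar> ^ N)"
proof -
  \<comment> \<open>The exponent 1/(\<alpha>-1) of the threshold, rounded up to a natural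
    number.\<close>
  define N where "N = nat \<lceil>1 / (\<alpha> - 1)\<rceil>"
  have triv: "\<bar>airy_partial \<alpha> x R\<bar> \<le> R" if "0 \<le> R" for x R
  proof -
    have "norm (integral {0..R} (\<lambda>s. cos (s * x + s powr \<alpha> / \<alpha>))) \<le> integral {0..R} (\<lambda>s. 1)"
      using \<alpha> by (intro integral_norm_bound_integral airy_integrand_integrable) auto
    then show ?thesis using that by (simp add: airy_partial_def)
  qed
  have "\<bar>airy_partial \<alpha> x R\<bar> \<le> (2 + 2 ^ N) * (1 + \<bar>x\<bar> ^ N)" if "0 \<le> R" for x R
  proof -
    define K where "K = (1 + \<bar>x\<bar>) powr (1 / (\<alpha> - 1))"
    have "\<bar>airy_partial \<alpha> x R\<bar> \<le> K + 2"
    proof (cases "R \<le> K")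
      case True
      then show ?thesis using triv [OF that, of x] by linarith
    next
      case False
      note * = airy_partial_diff_bound [OF \<alpha>, of x K R]
      have "2 / (x + K powr (\<alpha> - 1)) \<le> 2"
        using * False by (simp add: K_def pos_divide_le_eq)
      moreover have "0 \<le> K" by (simp add: K_def)
      ultimately show ?thesis using *(1) False triv [of K x] unfolding K_def by linarith
    qed
    moreover have "K \<le> 2 ^ N * (1 + \<bar>x\<bar> ^ N)"
    proof -
      have "1 / (\<alpha> - 1) \<le> real N"
        unfolding N_def by linarith
      then have "K \<le> (1 + \<bar>x\<bar>) powr real N"
        unfolding K_def by (intro powr_mono) auto
      also have "\<dots> = (1 + \<bar>x\<bar>) ^ N"
        by (simp add: powr_realpow)
      also have "\<dots> \<le> (2 * max 1 \<bar>x\<bar>) ^ N"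
        by (intro power_mono) auto
      also have "\<dots> \<le> 2 ^ N * (1 + \<bar>x\<bar> ^ N)"
        by (auto simp: power_mult_distrib max_def)
      finally show ?thesis .
    qed
    moreover have "2 \<le> 2 * (1 + \<bar>x\<bar> ^ N)" by simp
    ultimately have "\<bar>airy_partial \<alpha> x R\<bar> \<le> 2 ^ N * (1 + \<bar>x\<bar> ^ N) + 2 * (1 + \<bar>x\<bar> ^ N)"
      by linarith
    then show ?thesis by (simp add: algebra_simps)
  qed
  then show thesis by (rule that)
qed

section \<open>The truncated inverse transform in terms of Airy integrals\<close>

text \<open>Pairs the contributions of \<gamma> and -\<gamma>; it is applied with \<open>b\<close>
  the phase and \<open>a\<close> equal to plus or minus x * \<gamma>.\<close>

lemma conjugate_exp_products_eq_cos:
  fixes a b :: real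
  shows "exp (\<i> * of_real (- a)) * exp (\<i> * of_real b) + exp (\<i> * of_real a) * exp (\<i> * of_real (- b))
    = of_real (2 * cos (b - a))"
  unfolding exp_add [symmetric] cos_of_real [symmetric] of_real_mult cos_exp_eq
  by (simp add: algebra_simps)

text \<open>The phase \<sigma>, here including the factor \<open>t\<close>, is odd, so the integral
  folds onto [0, n] and becomes a combination of real cosines. As c^\<alpha> = \<alpha> t, the
  substitution s = c \<gamma> turns t \<gamma>^\<alpha> into s^\<alpha>/\<alpha> and the cutoff n
  into c n.\<close>

lemma fourier_test_truncated_phase:
  fixes \<alpha> t p x :: real and n :: nat
  assumes \<alpha>: "\<alpha> > 1" and t: "t > 0"
  defines "\<sigma> \<equiv> \<lambda>\<gamma>. t * (\<gamma> * \<bar>\<gamma>\<bar> powr (\<alpha> - 1))" and "c \<equiv> (\<alpha> * t) powr (1 / \<alpha>)"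
  shows "fourier_test (\<lambda>\<gamma>. indicator {- real n..real n} \<gamma> *
      (of_real p * exp (\<i> * of_real (\<sigma> \<gamma>)) + of_real (1 - p) * exp (\<i> * of_real (- \<sigma> \<gamma>)))) (- x) / (2 * pi) =
    of_real ((p * airy_partial \<alpha> (- (x / c)) (c * n) + (1 - p) * airy_partial \<alpha> (x / c) (c * n)) / (pi * c))"
proof -
  define E where "E \<gamma> = exp (\<i> * of_real (- x * \<gamma>)) *
    (of_real p * exp (\<i> * of_real (\<sigma> \<gamma>)) + of_real (1 - p) * exp (\<i> * of_real (- \<sigma> \<gamma>)))" for \<gamma>
  have \<sigma>c: "continuous_on A \<sigma>" for A
    unfolding \<sigma>_def using \<alpha> by (intro continuous_intros continuous_on_powr') auto
  have Ec: "continuous_on A E" for A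
    unfolding E_def [abs_def] by (intro continuous_intros \<sigma>c)
  have Ei: "E integrable_on {a..b}" for a b
    by (intro integrable_continuous_interval Ec)
  have \<sigma>_minus: "\<sigma> (- \<gamma>) = - \<sigma> \<gamma>" for \<gamma>
    by (simp add: \<sigma>_def)
  have c: "0 < c" using \<alpha> t by (simp add: c_def)
  have c_powr: "c powr \<alpha> = \<alpha> * t" using \<alpha> t by (simp add: c_def powr_powr)
  have \<sigma>_scale: "\<sigma> \<gamma> = (c * \<gamma>) powr \<alpha> / \<alpha>" if "0 \<le> \<gamma>" for \<gamma>
  proof (cases "\<gamma> = 0")
    case False
    then have "\<gamma> * \<bar>\<gamma>\<bar> powr (\<alpha> - 1) = \<gamma> powr \<alpha>"
      using that by (simp add: powr_mult_base)
    then show ?thesis using that \<alpha> c by (simp add: \<sigma>_def powr_mult c_powr)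
  qed (simp add: \<sigma>_def)
  define I where "I y = integral {0..real n} (\<lambda>\<gamma>. cos (\<sigma> \<gamma> + y * \<gamma>))" for y
  have I: "I y = airy_partial \<alpha> (y / c) (c * n) / c" for y
  proof -
    have "(\<lambda>x. x / c) ` {0..c * n} = {0..real n}"
      using c by (simp add: image_divide_atLeastAtMost)
    then have "airy_partial \<alpha> (y / c) (c * n) / c =
        integral {0..real n} (\<lambda>\<gamma>. cos (c * \<gamma> * (y / c) + (c * \<gamma>) powr \<alpha> / \<alpha>))"
      using integral_stretch_real [of c 0 "c * n" "\<lambda>s. cos (s * (y / c) + s powr \<alpha> / \<alpha>)"] c
      by (simp add: airy_partial_def)
    also have "\<dots> = I y"
      unfolding I_def using c
      by (intro Henstock_Kurzweil_Integration.integral_cong) (auto simp: \<sigma>_scale add.commute mult.commute)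
    finally show ?thesis ..
  qed
  have Ii: "(\<lambda>\<gamma>. cos (\<sigma> \<gamma> + y * \<gamma>)) integrable_on {a..b}" for y a b
    by (intro integrable_continuous_interval continuous_intros \<sigma>c)
  \<comment> \<open>Reflection swaps the two exponentials of the phase; regrouping by the weights
    \<open>p\<close> and \<open>1 - p\<close> leaves two conjugate pairs.\<close>
  have E_sym: "E \<gamma> + E (- \<gamma>) =
      of_real (2 * p * cos (\<sigma> \<gamma> + - x * \<gamma>) + 2 * (1 - p) * cos (\<sigma> \<gamma> + x * \<gamma>))" for \<gamma>
  proof -
    have "E \<gamma> + E (- \<gamma>) =
        of_real p * (exp (\<i> * of_real (- (x * \<gamma>))) * exp (\<i> * of_real (\<sigma> \<gamma>))
          + exp (\<i> * of_real (x * \<gamma>)) * exp (\<i> * of_real (- \<sigma> \<gamma>)))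
        + of_real (1 - p) * (exp (\<i> * of_real (- (- (x * \<gamma>)))) * exp (\<i> * of_real (\<sigma> \<gamma>))
          + exp (\<i> * of_real (- (x * \<gamma>))) * exp (\<i> * of_real (- \<sigma> \<gamma>)))"
      by (simp add: E_def \<sigma>_minus algebra_simps)
    also have "\<dots> = of_real p * of_real (2 * cos (\<sigma> \<gamma> - x * \<gamma>))
        + of_real (1 - p) * of_real (2 * cos (\<sigma> \<gamma> - - (x * \<gamma>)))"
      by (simp only: conjugate_exp_products_eq_cos)
    finally show ?thesis by simp
  qed
  have "fourier_test (\<lambda>\<gamma>. indicator {- real n..real n} \<gamma> *
      (of_real p * exp (\<i> * of_real (\<sigma> \<gamma>)) + of_real (1 - p) * exp (\<i> * of_real (- \<sigma> \<gamma>)))) (- x)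
    = (LINT \<gamma>:{- real n..real n}|lborel. E \<gamma>)"
    unfolding fourier_test_def set_lebesgue_integral_def E_def
    by (intro Bochner_Integration.integral_cong) (auto simp: indicator_def)
  also have "\<dots> = integral {- real n..real n} E"
    by (intro set_borel_integral_eq_integral borel_integrable_atLeastAtMost' Ec)
  also have "\<dots> = integral {- real n..0} E + integral {0..real n} E"
    by (rule Henstock_Kurzweil_Integration.integral_combine [symmetric]) (auto intro: Ei)
  also have "integral {- real n..0} E = integral {0..real n} (\<lambda>\<gamma>. E (- \<gamma>))"
    using Henstock_Kurzweil_Integration.integral_reflect_real [of "real n" 0 "\<lambda>\<gamma>. E (- \<gamma>)"] by simp
  also have "\<dots> + integral {0..real n} E = integral {0..real n} (\<lambda>\<gamma>. E (- \<gamma>) + E \<gamma>)"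
    by (rule Henstock_Kurzweil_Integration.integral_add [symmetric])
      (auto intro!: Ei integrable_continuous_interval continuous_on_compose2 [OF Ec] continuous_intros)
  also have "\<dots> = integral {0..real n} (\<lambda>\<gamma>.
      complex_of_real (2 * p * cos (\<sigma> \<gamma> + - x * \<gamma>) + 2 * (1 - p) * cos (\<sigma> \<gamma> + x * \<gamma>)))"
    using E_sym by (simp add: add.commute)
  also have "\<dots> = of_real (integral {0..real n} (\<lambda>\<gamma>.
      2 * p * cos (\<sigma> \<gamma> + - x * \<gamma>) + 2 * (1 - p) * cos (\<sigma> \<gamma> + x * \<gamma>)))"
    by (intro integral_unique has_integral_of_real integrable_integral
        Henstock_Kurzweil_Integration.integrable_add integrable_on_mult_right Ii)
  also have "\<dots> = of_real (2 * p * I (- x) + 2 * (1 - p) * I x)"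
    unfolding I_def
    by (simp only: Henstock_Kurzweil_Integration.integral_add integrable_on_mult_right Ii
        Henstock_Kurzweil_Integration.integral_mult_right)
  finally show ?thesis
    using c by (simp add: I field_simps)
qed

section \<open>Transform of the Airy solution and its differential equation\<close>

theorem mainTheorem7:
  fixes \<alpha> p :: real
  assumes "\<alpha> > 1" and "0 \<le> p" and "p \<le> 1"
  shows "\<exists>U :: real \<Rightarrow> real \<Rightarrow> complex.
    (\<forall>t>0. continuous_on UNIV (\<lambda>\<gamma>. U \<gamma> t) \<and>
       has_fourier_transform (\<lambda>x. complex_of_real (airy_sol \<alpha> p x t)) (\<lambda>\<gamma>. U \<gamma> t)) \<and>
    (\<forall>\<gamma>. \<exists>V :: real \<Rightarrow> complex. \<forall>t>0.
       ((\<lambda>s. U \<gamma> s) has_vector_derivative V t) (at t) \<and>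
       (V has_vector_derivative (- (\<bar>\<gamma>\<bar> powr (2 * \<alpha>)) *\<^sub>R U \<gamma> t)) (at t))"
proof -
  \<comment> \<open>The signed power sgn(\<gamma>)|\<gamma>|^\<alpha>, in a form whose continuity at
    0 follows from \<alpha> > 1. \<open>V\<close> below is the time derivative of
    \<open>U\<close>.\<close>
  define \<sigma> where "\<sigma> \<gamma> = \<gamma> * \<bar>\<gamma>\<bar> powr (\<alpha> - 1)" for \<gamma> :: real
  define U where "U \<gamma> t = of_real p * exp (\<i> * of_real (t * \<sigma> \<gamma>))
    + of_real (1 - p) * exp (\<i> * of_real (- (t * \<sigma> \<gamma>)))" for \<gamma> t
  define V where "V \<gamma> t = \<i> * of_real (\<sigma> \<gamma>) * (of_real p * exp (\<i> * of_real (t * \<sigma> \<gamma>))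
    - of_real (1 - p) * exp (\<i> * of_real (- (t * \<sigma> \<gamma>))))" for \<gamma> t
  have \<sigma>_sq: "(\<sigma> \<gamma>)\<^sup>2 = \<bar>\<gamma>\<bar> powr (2 * \<alpha>)" for \<gamma>
  proof (cases "\<gamma> = 0")
    case False
    then have "\<bar>\<sigma> \<gamma>\<bar> = \<bar>\<gamma>\<bar> powr \<alpha>"
      by (simp add: \<sigma>_def abs_mult powr_mult_base)
    then have "\<bar>\<sigma> \<gamma>\<bar>\<^sup>2 = (\<bar>\<gamma>\<bar> powr \<alpha>) powr 2"
      by simp
    then show ?thesis by (simp add: powr_powr mult.commute)
  qed (simp add: \<sigma>_def)
  have "continuous_on UNIV \<sigma>"
    unfolding \<sigma>_def [abs_def] using assms by (intro continuous_intros continuous_on_powr') auto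
  then have contU: "continuous_on UNIV (\<lambda>\<gamma>. U \<gamma> t)" for t
    unfolding U_def by (intro continuous_intros)
  have "has_fourier_transform (\<lambda>x. complex_of_real (airy_sol \<alpha> p x t)) (\<lambda>\<gamma>. U \<gamma> t)"
    if t: "t > 0" for t
  proof -
    define c where "c = (\<alpha> * t) powr (1 / \<alpha>)"
    have c: "0 < c" using assms t by (simp add: c_def)
    define u where "u n x = (p * airy_partial \<alpha> (- (x / c)) (c * real n)
      + (1 - p) * airy_partial \<alpha> (x / c) (c * real n)) / (pi * c)" for n x
    have u: "fourier_test (\<lambda>\<gamma>. indicator {- real n..real n} \<gamma> * U \<gamma> t) (- x) / (2 * pi) = of_real (u n x)"
      for n x
      unfolding U_def \<sigma>_def u_def c_def by (rule fourier_test_truncated_phase) (use assms t in auto)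
    have lim: "(\<lambda>n. u n x) \<longlonglongrightarrow> airy_sol \<alpha> p x t" for x
    proof -
      \<comment> \<open>The rescaled cutoffs c n are real, hence the need for the limit of
        \<open>airy_partial\<close> over all real cutoffs.\<close>
      have "filterlim (\<lambda>n. c * real n) at_top sequentially"
        using c by real_asymp
      note * = filterlim_compose [OF airy_partial_tendsto [OF assms(1)] this]
      have "(\<lambda>n. u n x) \<longlonglongrightarrow> (p * (pi * Airy_gen \<alpha> (- (x / c)))
          + (1 - p) * (pi * Airy_gen \<alpha> (x / c))) / (pi * c)"
        unfolding u_def using c by (intro tendsto_intros *) auto
      moreover have "(p * (pi * Airy_gen \<alpha> (- (x / c))) + (1 - p) * (pi * Airy_gen \<alpha> (x / c))) / (pi * c)
          = airy_sol \<alpha> p x t"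
        using c unfolding airy_sol_def c_def [symmetric] by (simp add: field_simps)
      ultimately show ?thesis by simp
    qed
    obtain C N where CN: "\<And>x R. 0 \<le> R \<Longrightarrow> \<bar>airy_partial \<alpha> x R\<bar> \<le> C * (1 + \<bar>x\<bar> ^ N)"
      using airy_partial_bound [OF assms(1)] by blast
    have C: "0 \<le> C"
      using CN [of 0 1] by (simp add: zero_le_mult_iff)
    \<comment> \<open>The uniform Airy bound is taken at x/c and -x/c; the factor 1 + 1/c^N absorbs
      the rescaling, and the convex weights add up to 1.\<close>
    have bnd: "\<bar>u n x\<bar> \<le> C / (pi * c) * (1 + 1 / c ^ N) * (1 + \<bar>x\<bar> ^ N)" for n x
    proof -
      have "\<bar>p * airy_partial \<alpha> (- (x / c)) (c * real n) + (1 - p) * airy_partial \<alpha> (x / c) (c * real n)\<bar>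
          \<le> p * (C * (1 + \<bar>x / c\<bar> ^ N)) + (1 - p) * (C * (1 + \<bar>x / c\<bar> ^ N))"
        using assms c CN [of "c * real n" "- (x / c)"] CN [of "c * real n" "x / c"]
        by (intro order_trans [OF abs_triangle_ineq] add_mono) (auto simp: abs_mult intro!: mult_left_mono)
      also have "\<dots> = C * (1 + \<bar>x\<bar> ^ N / c ^ N)"
        using c by (simp add: power_divide flip: distrib_right)
      also have "\<dots> \<le> C * ((1 + 1 / c ^ N) * (1 + \<bar>x\<bar> ^ N))"
        using C c by (intro mult_left_mono) (auto simp: algebra_simps)
      finally show ?thesis
        using c by (simp add: u_def abs_divide abs_mult divide_right_mono)
    qed
    show ?thesis
    proof (rule has_fourier_transform_LIMSEQ [where C="C / (pi * c) * (1 + 1 / c ^ N)" and N=N])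
      show "(\<lambda>\<gamma>. U \<gamma> t) \<in> borel_measurable borel"
        by (rule borel_measurable_continuous_onI [OF contU])
      \<comment> \<open>A convex combination of unimodular numbers: this is where p in [0,1]
        enters.\<close>
      show "norm (U \<gamma> t) \<le> 1" for \<gamma>
        unfolding U_def by (rule order_trans [OF norm_triangle_ineq])
          (use assms in \<open>simp del: of_real_mult of_real_diff of_real_minus add: norm_mult\<close>)
    qed (simp_all only: u norm_of_real bnd tendsto_of_real lim)
  qed
  moreover have "((\<lambda>s. U \<gamma> s) has_vector_derivative V \<gamma> t) (at t)"
    "(V \<gamma> has_vector_derivative (- (\<bar>\<gamma>\<bar> powr (2 * \<alpha>)) *\<^sub>R U \<gamma> t)) (at t)" for \<gamma> t
  proof -
    show "((\<lambda>s. U \<gamma> s) has_vector_derivative V \<gamma> t) (at t)"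
      unfolding U_def V_def of_real_mult of_real_minus
      by (rule has_vector_derivative_real_field)
        (auto intro!: derivative_eq_intros simp: algebra_simps)
    have "(V \<gamma> has_vector_derivative (- (of_real ((\<sigma> \<gamma>)\<^sup>2)) * U \<gamma> t)) (at t)"
      unfolding U_def V_def [abs_def] of_real_mult of_real_minus
      by (rule has_vector_derivative_real_field)
        (auto intro!: derivative_eq_intros simp: algebra_simps power2_eq_square)
    then show "(V \<gamma> has_vector_derivative (- (\<bar>\<gamma>\<bar> powr (2 * \<alpha>)) *\<^sub>R U \<gamma> t)) (at t)"
      by (simp add: \<sigma>_sq scaleR_conv_of_real)
  qed
  ultimately show ?thesis
    using contU by (intro exI [of _ U]) blast
qed

end
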